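(* For any $\theta>0$, there exists a potential $V\in L^1(\mathbb{R})$ with compact support such that the Schr\"odinger operator $-\frac{d^2}{dx^2}+V(x)$ has a zero-energy resonance with a half-bound state $u$ satisfying $$\frac{u(+\infty)}{u(-\infty)}=\theta.$$
   Context: Potentials are real-valued functions on $\mathbb{R}$. The operator $-\frac{d^2}{dx^2}+V$ (or the potential $V$) is said to have a zero-energy resonance if the equation $-u''+Vu=0$ has a nontrivial solution $u$ that is bounded on the whole line; such a $u$ is called a half-bound state. A half-bound state has nonzero limits $u(\pm\infty)=\lim_{x\to\pm\infty}u(x)$. *)

theory Defs
  imports "HOL-Analysis.Analysis"
begin

text \<open>The usual epsilon-delta absolute continuity of a function on \<open>{a..b}\<close>. A finite family of
  non-overlapping closed subintervals of \<open>{a..b}\<close> is given as a division \<open>d\<close> of some \<open>T \<subseteq> {a..b}\<close>;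
  a member \<open>K = {p..q}\<close> has \<open>Inf K = p\<close>, \<open>Sup K = q\<close>.\<close>

definition abs_cont_on_interval :: "real \<Rightarrow> real \<Rightarrow> (real \<Rightarrow> real) \<Rightarrow> bool" where
  "abs_cont_on_interval a b f \<longleftrightarrow>
    (\<forall>\<epsilon>>0. \<exists>\<delta>>0. \<forall>d T. d division_of T \<and> T \<subseteq> {a..b} \<and> (\<Sum>K\<in>d. Sup K - Inf K) < \<delta>
      \<longrightarrow> (\<Sum>K\<in>d. \<bar>f (Sup K) - f (Inf K)\<bar>) < \<epsilon>)"

definition locally_abs_cont :: "(real \<Rightarrow> real) \<Rightarrow> bool" where
  "locally_abs_cont f \<longleftrightarrow> (\<forall>a b. abs_cont_on_interval a b f)"

text \<open>Since \<open>V\<close> is merely integrable, \<open>- u'' + V u = 0\<close> is understood in the Caratheodory sense: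
  \<open>u\<close> is differentiable, \<open>u'\<close> is locally absolutely continuous, and the equation holds almost
  everywhere.\<close>

definition schroedinger_zero_solution :: "(real \<Rightarrow> real) \<Rightarrow> (real \<Rightarrow> real) \<Rightarrow> bool" where
  "schroedinger_zero_solution V u \<longleftrightarrow>
    (\<exists>u'. (\<forall>x. (u has_real_derivative u' x) (at x)) \<and> locally_abs_cont u' \<and>
      (AE x in lebesgue. \<exists>u''. (u' has_real_derivative u'') (at x) \<and> - u'' + V x * u x = 0))"

definition half_bound_state :: "(real \<Rightarrow> real) \<Rightarrow> (real \<Rightarrow> real) \<Rightarrow> bool" where
  "half_bound_state V u \<longleftrightarrow>
    schroedinger_zero_solution V u \<and> (\<exists>x. u x \<noteq> 0) \<and> bounded (range u)"

definition zero_energy_resonance :: "(real \<Rightarrow> real) \<Rightarrow> bool" where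
  "zero_energy_resonance V \<longleftrightarrow> (\<exists>u. half_bound_state V u)"

end

theory Submission
  imports Defs
begin

text \<open>Any positive \<open>C\<^sup>2\<close> function \<open>u\<close> that is constant outside a compact interval is a half-bound
  state of the continuous, compactly supported potential \<open>V = u'' / u\<close>. So it suffices to let \<open>u\<close>
  climb from \<open>1\<close> to \<open>\<theta>\<close>; this is done with the cubic spline below.\<close>

text \<open>Off the knot \<open>a\<close> the function agrees locally with 0 or with a pure power.
  At the knot an exponent of at least 2 leaves a positive power in the difference quotient, which
  forces it to 0.\<close>

lemma truncated_power_deriv:
  fixes a x :: real
  shows "((\<lambda>x. max 0 (x - a) ^ Suc (Suc n)) has_real_derivative
    real (Suc (Suc n)) * max 0 (x - a) ^ Suc n) (at x)"
proof -
  consider "x < a" | "x = a" | "x > a" by linarith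
  then show ?thesis
  proof cases
    case 1
    have "((\<lambda>x. 0) has_real_derivative real (Suc (Suc n)) * max 0 (x - a) ^ Suc n) (at x)"
      using 1 by simp
    then show ?thesis
      by (rule has_field_derivative_transform_within_open[of _ _ _ "{..<a}"]) (use 1 in auto)
  next
    case 2
    \<comment> \<open>This is the difference quotient at the knot, with one factor split off so that
      the ratio takes only the values 0 and 1 (at \<open>y = a\<close> it is 0, as division by zero
      gives 0).\<close>
    have "((\<lambda>y. max 0 (y - a) ^ Suc n * (max 0 (y - a) / (y - a))) \<longlongrightarrow> 0) (at a)"
    proof (rule Lim_null_comparison)
      show "\<forall>\<^sub>F y in at a. norm (max 0 (y - a) ^ Suc n * (max 0 (y - a) / (y - a))) \<le> \<bar>y - a\<bar> ^ Suc n"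
        by (intro always_eventually) (auto simp: max_def)
      show "((\<lambda>y. \<bar>y - a\<bar> ^ Suc n) \<longlongrightarrow> 0) (at a)"
        by (rule tendsto_eq_intros refl | simp)+
    qed
    then show ?thesis
      using 2 by (simp add: has_field_derivative_iff mult_ac)
  next
    case 3
    have "((\<lambda>x. (x - a) ^ Suc (Suc n)) has_real_derivative
        real (Suc (Suc n)) * max 0 (x - a) ^ Suc n) (at x)"
      using 3 DERIV_power[of "\<lambda>x. x - a" 1 x UNIV "Suc (Suc n)"]
      by (auto intro!: derivative_eq_intros simp del: power_Suc)
    then show ?thesis
      by (rule has_field_derivative_transform_within_open[of _ _ _ "{a<..}"]) (use 3 in auto)
  qed
qed

lemma lipschitz_imp_locally_abs_cont:
  fixes f :: "real \<Rightarrow> real"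
  assumes "\<And>x y. \<bar>f x - f y\<bar> \<le> M * \<bar>x - y\<bar>"
  shows "locally_abs_cont f"
  unfolding locally_abs_cont_def abs_cont_on_interval_def
proof (intro allI impI)
  fix a b \<epsilon> :: real
  assume "\<epsilon> > 0"
  \<comment> \<open>\<open>M\<close> may be 0; the maximum keeps the divisor in \<delta> =
    \<open>\<epsilon> / N\<close> positive.\<close>
  define N where "N = max M 1"
  have "N > 0" by (simp add: N_def)
  have "(\<Sum>K\<in>d. \<bar>f (Sup K) - f (Inf K)\<bar>) < \<epsilon>"
    if d: "d division_of T" and small: "(\<Sum>K\<in>d. Sup K - Inf K) < \<epsilon> / N" for d T
  proof -
    have "\<bar>f (Sup K) - f (Inf K)\<bar> \<le> N * (Sup K - Inf K)" if K: "K \<in> d" for K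
    proof -
      obtain p q where "K = cbox p q" "K \<noteq> {}"
        using division_ofD(3,4)[OF d K] by auto
      then have le: "Inf K \<le> Sup K" by auto
      have "\<bar>f (Sup K) - f (Inf K)\<bar> \<le> M * \<bar>Sup K - Inf K\<bar>" by (rule assms)
      also have "\<dots> \<le> N * \<bar>Sup K - Inf K\<bar>" by (rule mult_right_mono) (auto simp: N_def)
      finally show ?thesis using le by simp
    qed
    then have "(\<Sum>K\<in>d. \<bar>f (Sup K) - f (Inf K)\<bar>) \<le> N * (\<Sum>K\<in>d. Sup K - Inf K)"
      unfolding sum_distrib_left by (rule sum_mono)
    also have "\<dots> < \<epsilon>"
      using small \<open>N > 0\<close> by (simp add: field_simps)
    finally show ?thesis .
  qed
  moreover have "\<epsilon> / N > 0" using \<open>\<epsilon> > 0\<close> \<open>N > 0\<close> by simp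
  ultimately show "\<exists>\<delta>>0. \<forall>d T. d division_of T \<and> T \<subseteq> {a..b} \<and> (\<Sum>K\<in>d. Sup K - Inf K) < \<delta> \<longrightarrow>
      (\<Sum>K\<in>d. \<bar>f (Sup K) - f (Inf K)\<bar>) < \<epsilon>"
    by blast
qed

text \<open>By the mean value inequality \<open>M\<close> is a Lipschitz constant. This will be
  applied to the first derivative of the half-bound state.\<close>

lemma bounded_deriv_imp_locally_abs_cont:
  fixes f f' :: "real \<Rightarrow> real"
  assumes "\<And>x. (f has_real_derivative f' x) (at x)" "\<And>x. \<bar>f' x\<bar> \<le> M"
  shows "locally_abs_cont f"
proof (rule lipschitz_imp_locally_abs_cont)
  show "\<bar>f x - f y\<bar> \<le> M * \<bar>x - y\<bar>" for x y
    using field_differentiable_bound[of UNIV f f' M x y] assms by auto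
qed

text \<open>Cutting \<open>V\<close> off to the compact interval changes nothing, and a continuous
  function is Borel integrable there; integrability then passes to the completed measure.\<close>

lemma continuous_compact_support_integrable:
  fixes V :: "real \<Rightarrow> real"
  assumes "continuous_on UNIV V" "\<And>x. x \<notin> {a..b} \<Longrightarrow> V x = 0"
  shows "integrable lebesgue V"
proof -
  have "set_integrable lborel {a..b} V"
    by (rule borel_integrable_atLeastAtMost')
      (rule continuous_on_subset[OF assms(1)], simp)
  moreover have "(\<lambda>x. indicator {a..b} x *\<^sub>R V x) = V"
    using assms(2) by (fastforce simp: indicator_def)
  ultimately have "integrable lborel V"
    by (simp add: set_integrable_def)
  then show ?thesis
    by (simp add: integrable_completion borel_measurable_integrable)
qed

text \<open>The third difference of \<open>x\<^sup>3\<close> is the constant \<open>6\<close>, so the truncated cubes cancel to \<open>1\<close>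
  beyond the last knot.\<close>

definition step :: "real \<Rightarrow> real" where
  "step x = (max 0 (x - 0) ^ 3 - 3 * max 0 (x - 1) ^ 3 + 3 * max 0 (x - 2) ^ 3 - max 0 (x - 3) ^ 3) / 6"

text \<open>This is the quadratic B-spline with knots 0, 1, 2, 3, a nonnegative bump supported on
  \<open>{0..3}\<close>.\<close>

definition step' :: "real \<Rightarrow> real" where
  "step' x = (max 0 (x - 0) ^ 2 - 3 * max 0 (x - 1) ^ 2 + 3 * max 0 (x - 2) ^ 2 - max 0 (x - 3) ^ 2) / 2"

definition step'' :: "real \<Rightarrow> real" where
  "step'' x = max 0 (x - 0) - 3 * max 0 (x - 1) + 3 * max 0 (x - 2) - max 0 (x - 3)"

lemma step_deriv: "(step has_real_derivative step' x) (at x)"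
proof -
  have D: "((\<lambda>x. max 0 (x - a) ^ 3) has_real_derivative 3 * max 0 (x - a) ^ 2) (at x)" for a
    using truncated_power_deriv[of a 1 x] by (simp add: numeral_2_eq_2 numeral_3_eq_3)
  show ?thesis
    unfolding step_def[abs_def] step'_def
    by (rule DERIV_cong[OF DERIV_cdivide[OF DERIV_diff[OF DERIV_add[OF DERIV_diff[OF
      D[of 0] DERIV_cmult[OF D[of 1]]] DERIV_cmult[OF D[of 2]]] D[of 3]]]]) simp
qed

lemma step'_deriv: "(step' has_real_derivative step'' x) (at x)"
proof -
  have D: "((\<lambda>x. max 0 (x - a) ^ 2) has_real_derivative 2 * max 0 (x - a)) (at x)" for a
    using truncated_power_deriv[of a 0 x] by (simp add: numeral_2_eq_2)
  show ?thesis
    unfolding step'_def[abs_def] step''_def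
    by (rule DERIV_cong[OF DERIV_cdivide[OF DERIV_diff[OF DERIV_add[OF DERIV_diff[OF
      D[of 0] DERIV_cmult[OF D[of 1]]] DERIV_cmult[OF D[of 2]]] D[of 3]]]]) simp
qed

lemma step_left: "x \<le> 0 \<Longrightarrow> step x = 0"
  by (simp add: step_def)

lemma step_right: "x \<ge> 3 \<Longrightarrow> step x = 1"
  by (simp add: step_def field_simps power3_eq_cube)

lemma step''_outside: "x \<notin> {0..3} \<Longrightarrow> step'' x = 0"
  by (auto simp: step''_def max_def)

text \<open>The graph is piecewise linear through (0,0), (1,1), (2,-1), (3,0); any finite bound
  serves the Lipschitz estimate.\<close>

lemma step''_bound: "\<bar>step'' x\<bar> \<le> 4"
  by (auto simp: step''_def max_def)

lemma step'_nonneg: "step' x \<ge> 0"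
proof -
  consider "x \<le> 1" | "1 \<le> x" "x \<le> 2" | "2 \<le> x" "x \<le> 3" | "x \<ge> 3" by linarith
  then show ?thesis
  proof cases
    case 1
    then show ?thesis by (simp add: step'_def)
  next
    case 2
    \<comment> \<open>Completing the square centres the middle piece at its vertex 3/2. The interval
      lies within 1/2 of it, so the value is at least 1/2.\<close>
    then have "step' x = 3/4 - (x - 3/2)^2"
      by (simp add: step'_def field_simps power2_eq_square)
    moreover have "(x - 3/2)^2 \<le> (1/2)^2"
      using 2 by (intro abs_le_square_iff[THEN iffD1]) (simp add: abs_if)
    ultimately show ?thesis by (simp add: power2_eq_square)
  next
    case 3
    then have "step' x = (3 - x)^2 / 2"
      by (simp add: step'_def field_simps power2_eq_square)
    then show ?thesis by (simp only: zero_le_power2 zero_le_divide_iff) simp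
  next
    case 4
    then show ?thesis by (simp add: step'_def field_simps power2_eq_square)
  qed
qed

lemma step_bounds: "0 \<le> step x" "step x \<le> 1"
proof -
  have mono: "step x \<le> step y" if "x \<le> y" for x y
    using that step_deriv step'_nonneg by (blast intro: DERIV_nonneg_imp_nondecreasing)
  \<comment> \<open>The points \<open>min x 0\<close> and \<open>max x 3\<close> lie on the flat
    ends, where the value is known, so monotonicity covers every \<open>x\<close> at once.\<close>
  show "0 \<le> step x" using mono[of "min x 0" x] by (simp add: step_left)
  show "step x \<le> 1" using mono[of x "max x 3"] by (simp add: step_right)
qed

theorem lemma1:
  fixes \<theta> :: real
  assumes "\<theta> > 0"
  shows "\<exists>V :: real \<Rightarrow> real.
    integrable lebesgue V \<and> compact (closure {x. V x \<noteq> 0}) \<and>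
    zero_energy_resonance V \<and>
    (\<exists>u u_minus u_plus. half_bound_state V u \<and>
      (u \<longlongrightarrow> u_minus) at_bot \<and> (u \<longlongrightarrow> u_plus) at_top \<and>
      u_minus \<noteq> 0 \<and> u_plus \<noteq> 0 \<and> u_plus / u_minus = \<theta>)"
proof -
  define u where "u x = 1 + (\<theta> - 1) * step x" for x
  define u' where "u' x = (\<theta> - 1) * step' x" for x
  define u'' where "u'' x = (\<theta> - 1) * step'' x" for x
  define V where "V x = u'' x / u x" for x
  have du: "(u has_real_derivative u' x) (at x)" for x
    unfolding u_def[abs_def] u'_def by (rule derivative_eq_intros step_deriv refl | simp)+
  have du': "(u' has_real_derivative u'' x) (at x)" for x
    unfolding u'_def[abs_def] u''_def by (rule derivative_eq_intros step'_deriv refl | simp)+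
  \<comment> \<open>As a convex combination of 1 and \<theta>, \<open>u\<close> stays between them
    whichever is larger; this gives both positivity and boundedness.\<close>
  have u_convex: "u x = (1 - step x) * 1 + step x * \<theta>" for x
    by (simp add: u_def algebra_simps)
  \<comment> \<open>The upper bound for convex combinations is applied to the negatives of 1 and
    \<theta>.\<close>
  have u_lower: "min 1 \<theta> \<le> u x" for x
    unfolding u_convex
    using step_bounds[of x] convex_bound_le[of "-1" "- min 1 \<theta>" "-\<theta>" "1 - step x" "step x"]
    by simp
  have u_upper: "u x \<le> max 1 \<theta>" for x
    unfolding u_convex
    using step_bounds[of x] convex_bound_le[of 1 "max 1 \<theta>" \<theta> "1 - step x" "step x"] by simp
  have u_pos: "u x > 0" for x
    using u_lower[of x] assms by linarith
  have "locally_abs_cont u'"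
  proof (rule bounded_deriv_imp_locally_abs_cont[OF du'])
    show "\<bar>u'' x\<bar> \<le> \<bar>\<theta> - 1\<bar> * 4" for x
      unfolding u''_def abs_mult by (intro mult_left_mono step''_bound) simp
  qed
  \<comment> \<open>Since \<open>u\<close> has no zeros, the quotient defining \<open>V\<close>
    cancels at every point, so the equation holds in particular almost everywhere.\<close>
  moreover have "- u'' x + V x * u x = 0" for x
    using u_pos[of x] by (simp add: V_def)
  ultimately have "schroedinger_zero_solution V u"
    unfolding schroedinger_zero_solution_def using du du' by blast
  moreover have "bounded (range u)"
    using u_lower u_upper by (intro bounded_subset[OF bounded_closed_interval]) auto
  moreover have "u 0 \<noteq> 0" using u_pos[of 0] by simp
  ultimately have state: "half_bound_state V u"
    unfolding half_bound_state_def by blast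
  have V_outside: "V x = 0" if "x \<notin> {0..3}" for x
    using step''_outside[OF that] by (simp add: V_def u''_def)
  have "continuous_on UNIV u''"
    unfolding u''_def[abs_def] step''_def by (intro continuous_intros)
  moreover have "continuous_on UNIV u"
    using du by (meson DERIV_isCont continuous_at_imp_continuous_on)
  ultimately have "continuous_on UNIV V"
    unfolding V_def[abs_def] using u_pos
    by (intro continuous_on_divide) (auto simp: less_imp_neq[THEN not_sym])
  then have "integrable lebesgue V"
    using V_outside by (rule continuous_compact_support_integrable)
  moreover have "compact (closure {x. V x \<noteq> 0})"
    unfolding compact_closure
    by (rule bounded_subset[OF bounded_closed_interval[of 0 3]]) (use V_outside in blast)
  \<comment> \<open>Both limits are attained: \<open>u\<close> is constant to the left of 0 and to
    the right of 3.\<close>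
  moreover have "(u \<longlongrightarrow> 1) at_bot"
    by (rule tendsto_eventually, rule eventually_mono[OF eventually_le_at_bot[of 0]])
      (simp add: u_def step_left)
  moreover have "(u \<longlongrightarrow> \<theta>) at_top"
    by (rule tendsto_eventually, rule eventually_mono[OF eventually_ge_at_top[of 3]])
      (simp add: u_def step_right)
  ultimately show ?thesis
    using state assms unfolding zero_energy_resonance_def
    by (intro exI[of _ V] conjI exI[of _ u] exI[of _ 1] exI[of _ \<theta>]) auto
qed

end
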